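(* For every finite commutative ring $R$ with identity and every integer $k\ge 2$, $$zp_k(R)\le \mathcal{B}_k(2;1),$$ and equality holds if and only if $R\cong \mathbb{Z}_2$.
   Context: All rings are nonzero finite commutative rings with identity. For an integer $k\ge 2$, $zp_k(R)=|\{(x_1,\dots,x_k)\in R^k : x_1x_2\cdots x_k=0\}|/|R|^k$. For a prime $p$ and integers $\alpha>0$, $k\ge 2$, $$\mathcal{B}_k(p;\alpha)=\frac{p^{\alpha-1}\left\{p^k-(k+p-1)(p-1)^{k-1}\right\}+k(p-1)^{k-1}}{p^{k+\alpha-1}}.$$ $\mathbb{Z}_n$ is the ring of integers modulo $n$. *)

theory Defs
  imports "HOL-Algebra.Algebra" "HOL-Number_Theory.Residues" Complex_Main
begin

text \<open>A \<open>k\<close>-tuple over \<open>R\<close> is an extensional function on the index set \<open>{..<k}\<close>.\<close>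

definition zp :: "nat \<Rightarrow> ('a, 'm) ring_scheme \<Rightarrow> real" where
  "zp k R =
     real (card {x \<in> {..<k} \<rightarrow>\<^sub>E carrier R. (\<Otimes>\<^bsub>R\<^esub>i\<in>{..<k}. x i) = \<zero>\<^bsub>R\<^esub>})
       / real (card (carrier R)) ^ k"

text \<open>The numerator is computed in the reals, so only the exponents use truncated subtraction;
  the intended range is \<open>p\<close> prime, \<open>\<alpha> > 0\<close> and \<open>k \<ge> 2\<close>, where they do not truncate.\<close>

definition zp_bound :: "nat \<Rightarrow> nat \<Rightarrow> nat \<Rightarrow> real" where
  "zp_bound k p \<alpha> =
     (real p ^ (\<alpha> - 1) * (real p ^ k - (real k + real p - 1) * (real p - 1) ^ (k - 1))
        + real k * (real p - 1) ^ (k - 1))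
     / real p ^ (k + \<alpha> - 1)"

end

theory Submission
  imports Defs
begin

text \<open>
  Since \<open>zp_bound k 2 1 = 1 - 1 / 2 ^ k\<close>, the claim is that at least a \<open>1 / 2 ^ k\<close> fraction of all
  \<open>k\<close>-tuples has a nonzero product, and that this fraction is exact only for the ring with two
  elements.

  Choose a maximal ideal \<open>P\<close>; it is prime, so every tuple of elements outside \<open>P\<close> has its
  product outside \<open>P\<close>, hence a nonzero product. Adding \<open>\<one>\<close> maps \<open>P\<close> injectively into its
  complement, so the complement contains at least half of the ring and these tuples already make
  up the fraction \<open>1 / 2 ^ k\<close> (\<open>card_tuples_outside_prime\<close>, \<open>card_le_twice_card_compl_ideal\<close>).

  If the ring has more than two elements, one gains strictly. Either \<open>P\<close> contains some
  \<open>m \<noteq> \<zero>\<close>, and the tuple \<open>(m, \<one>, \<dots>, \<one>)\<close> has a nonzero product although it was not counted; or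
  \<open>P = {\<zero>}\<close>, and the complement of \<open>P\<close> is strictly more than half of the ring. In a ring with
  two elements only the tuple \<open>(\<one>, \<dots>, \<one>)\<close> has a nonzero product, and such a ring is a copy of the
  integers modulo \<open>2\<close>.
\<close>

section \<open>Tuples with a nonzero product\<close>

definition nonzero_tuples :: "nat \<Rightarrow> ('a, 'm) ring_scheme \<Rightarrow> (nat \<Rightarrow> 'a) set" where
  "nonzero_tuples k R =
     {x \<in> {..<k} \<rightarrow>\<^sub>E carrier R. (\<Otimes>\<^bsub>R\<^esub>i\<in>{..<k}. x i) \<noteq> \<zero>\<^bsub>R\<^esub>}"

lemma finite_nonzero_tuples:
  assumes "finite (carrier R)"
  shows "finite (nonzero_tuples k R)"
  unfolding nonzero_tuples_def using assms by (simp add: finite_PiE)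

lemma zp_eq_one_minus_nonzero:
  assumes fin: "finite (carrier R)" and ne: "carrier R \<noteq> {}"
  shows "zp k R = 1 - real (card (nonzero_tuples k R)) / real (card (carrier R)) ^ k"
proof -
  let ?T = "{..<k} \<rightarrow>\<^sub>E carrier R"
  let ?Z = "{x \<in> ?T. (\<Otimes>\<^bsub>R\<^esub>i\<in>{..<k}. x i) = \<zero>\<^bsub>R\<^esub>}"
  have "card ?T = card (?Z \<union> nonzero_tuples k R)"
    by (rule arg_cong[where f = card]) (auto simp: nonzero_tuples_def)
  also have "\<dots> = card ?Z + card (nonzero_tuples k R)"
    using fin by (intro card_Un_disjoint) (auto simp: nonzero_tuples_def finite_PiE)
  finally have "card (carrier R) ^ k = card ?Z + card (nonzero_tuples k R)"
    by (simp add: card_PiE)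
  then have "real (card ?Z) = real (card (carrier R)) ^ k - real (card (nonzero_tuples k R))"
    by (simp flip: of_nat_power)
  moreover have "card (carrier R) > 0"
    using assms by (simp add: card_gt_0_iff)
  ultimately show ?thesis
    unfolding zp_def by (simp add: diff_divide_distrib)
qed

lemma zp_bound_two_one: "zp_bound k 2 1 = 1 - 1 / 2 ^ k"
  unfolding zp_bound_def by (simp add: diff_divide_distrib)

section \<open>Ideals of a finite ring\<close>

context cring
begin

text \<open>A finite ring has only finitely many ideals, so some proper ideal is maximal for inclusion,
  and maximal ideals are prime.\<close>

lemma exists_primeideal_of_finite:
  assumes fin: "finite (carrier R)" and one: "\<one> \<noteq> \<zero>"
  obtains P where "primeideal P R"
proof -
  let ?A = "{I. ideal I R \<and> I \<noteq> carrier R}"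
  have "?A \<subseteq> Pow (carrier R)"
    using ideal.Icarr by fastforce
  then have "finite ?A"
    using fin by (meson finite_Pow_iff finite_subset)
  moreover have "{\<zero>} \<in> ?A"
    using zeroideal one one_closed by auto
  ultimately obtain P where P: "P \<in> ?A" and max: "\<And>J. J \<in> ?A \<Longrightarrow> P \<subseteq> J \<Longrightarrow> P = J"
    using finite_has_maximal[of ?A] by blast
  have "maximalideal P R"
    using P max by (intro maximalidealI) auto
  then show thesis
    using that maximalideal_prime by blast
qed

text \<open>Translation by \<open>\<one>\<close> embeds a proper ideal into its complement.\<close>

lemma card_le_twice_card_compl_ideal:
  assumes fin: "finite (carrier R)" and I: "ideal I R" and proper: "I \<noteq> carrier R"
  shows "card (carrier R) \<le> 2 * card (carrier R - I)"
proof -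
  interpret I: ideal I R by (rule I)
  have sub: "I \<subseteq> carrier R"
    using I.Icarr by blast
  have notin: "\<one> \<notin> I"
    using I.one_imp_carrier proper by blast
  have "x \<oplus> \<one> \<notin> I" if "x \<in> I" for x
  proof
    assume "x \<oplus> \<one> \<in> I"
    then have "\<ominus> x \<oplus> (x \<oplus> \<one>) \<in> I"
      using that by (simp add: I.a_inv_closed I.a_closed)
    then show False
      using notin that sub by (simp add: r_neg1 subsetD)
  qed
  then have "(\<lambda>x. x \<oplus> \<one>) ` I \<subseteq> carrier R - I"
    using sub by auto
  moreover have "inj_on (\<lambda>x. x \<oplus> \<one>) I"
    using sub by (intro inj_onI) (auto simp: subsetD)
  ultimately have "card I \<le> card (carrier R - I)"
    using fin by (metis card_image card_mono finite_Diff)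
  moreover have "card (carrier R) = card I + card (carrier R - I)"
    using fin sub by (metis card_Diff_subset card_mono finite_subset le_add_diff_inverse)
  ultimately show ?thesis by simp
qed

section \<open>Lower bounds from a prime ideal\<close>

lemma finprod_notin_primeideal:
  assumes "primeideal P R" and "finite A" and "\<And>i. i \<in> A \<Longrightarrow> x i \<in> carrier R - P"
  shows "(\<Otimes>i\<in>A. x i) \<notin> P"
proof -
  interpret P: primeideal P R by fact
  show ?thesis
    using assms(2,3)
  proof (induction A rule: finite_induct)
    case empty
    then show ?case
      using P.one_imp_carrier P.I_notcarr by auto
  next
    case (insert a A)
    have cl: "x \<in> A \<rightarrow> carrier R" "x a \<in> carrier R"
      using insert.prems by auto
    then show ?case
      using insert P.I_prime[of "x a" "finprod R x A"] by auto
  qed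
qed

text \<open>The complement of a prime ideal is closed under products and misses \<open>\<zero>\<close>. The bound cannot be
  sharp when \<open>P\<close> has a nonzero element \<open>m\<close>, because \<open>m\<close> itself is a nonzero product.\<close>

lemma card_tuples_outside_prime:
  assumes "finite (carrier R)" and "primeideal P R"
  shows "card (carrier R - P) ^ k \<le> card (nonzero_tuples k R)"
    and "P \<noteq> {\<zero>} \<Longrightarrow> k > 0 \<Longrightarrow> card (carrier R - P) ^ k < card (nonzero_tuples k R)"
proof -
  interpret P: primeideal P R by fact
  let ?T = "{..<k} \<rightarrow>\<^sub>E (carrier R - P)"
  have zero: "\<zero> \<in> P"
    by simp
  have card_T: "card ?T = card (carrier R - P) ^ k"
    by (simp add: card_PiE)
  have fin: "finite (nonzero_tuples k R)"
    using assms(1) by (rule finite_nonzero_tuples)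
  have sub: "?T \<subseteq> nonzero_tuples k R"
  proof
    fix x assume x: "x \<in> ?T"
    then have "(\<Otimes>i\<in>{..<k}. x i) \<notin> P"
      by (intro finprod_notin_primeideal[OF assms(2)]) auto
    then have "(\<Otimes>i\<in>{..<k}. x i) \<noteq> \<zero>"
      using zero by metis
    moreover have "x \<in> {..<k} \<rightarrow>\<^sub>E carrier R"
      using x PiE_mono[of "{..<k}" "\<lambda>_. carrier R - P" "\<lambda>_. carrier R"] by blast
    ultimately show "x \<in> nonzero_tuples k R"
      by (simp add: nonzero_tuples_def)
  qed
  show "card (carrier R - P) ^ k \<le> card (nonzero_tuples k R)"
    using card_mono[OF fin sub] card_T by simp
  assume "P \<noteq> {\<zero>}" and k: "k > 0"
  then obtain m where m: "m \<in> P" "m \<noteq> \<zero>"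
    using zero by blast
  then have m_cl: "m \<in> carrier R"
    by (simp add: P.Icarr)
  \<comment> \<open>The tuple \<open>(m, \<one>, \<dots>, \<one>)\<close> has the nonzero product \<open>m\<close> but meets \<open>P\<close>.\<close>
  define x where "x = restrict (\<lambda>j. if 0 = j then m else \<one>) {..<k}"
  have "(\<Otimes>i\<in>{..<k}. x i) = (\<Otimes>j\<in>{..<k}. if 0 = j then m else \<one>)"
    using m_cl by (intro finprod_cong) (auto simp: x_def simp_implies_def)
  also have "\<dots> = m"
    using finprod_singleton[of 0 "{..<k}" "\<lambda>_. m"] k m_cl by simp
  finally have "(\<Otimes>i\<in>{..<k}. x i) = m" .
  moreover have "x \<in> {..<k} \<rightarrow>\<^sub>E carrier R"
    using m_cl by (auto simp: x_def)
  ultimately have "x \<in> nonzero_tuples k R"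
    using m(2) unfolding nonzero_tuples_def by blast
  moreover have "x 0 \<in> P"
    using m k by (simp add: x_def)
  then have "x \<notin> ?T"
    using k by (auto simp: PiE_iff)
  ultimately have "?T \<subset> nonzero_tuples k R"
    using sub by blast
  then show "card (carrier R - P) ^ k < card (nonzero_tuples k R)"
    using psubset_card_mono[OF fin] card_T by metis
qed

text \<open>Strictness has two sources: a nonzero element of \<open>P\<close> gives an uncounted tuple, whereas for
  \<open>P = {\<zero>}\<close> the complement has \<open>n - 1 > n / 2\<close> elements, as \<open>n > 2\<close>.\<close>

lemma card_power_le_nonzero_tuples:
  assumes fin: "finite (carrier R)" and one: "\<one> \<noteq> \<zero>" and k: "k > 0"
  shows "card (carrier R) ^ k \<le> 2 ^ k * card (nonzero_tuples k R)"
    and "card (carrier R) \<noteq> 2 \<Longrightarrow> card (carrier R) ^ k < 2 ^ k * card (nonzero_tuples k R)"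
proof -
  obtain P where P: "primeideal P R"
    using exists_primeideal_of_finite[OF fin one] .
  interpret P: primeideal P R by (rule P)
  let ?n = "card (carrier R)" and ?s = "card (carrier R - P)"
  have half: "?n \<le> 2 * ?s"
    using card_le_twice_card_compl_ideal[OF fin P.is_ideal] P.I_notcarr by metis
  then have half_pow: "?n ^ k \<le> 2 ^ k * ?s ^ k"
    by (metis power_mono power_mult_distrib zero_le)
  note le = card_tuples_outside_prime[OF fin P, of k]
  show "?n ^ k \<le> 2 ^ k * card (nonzero_tuples k R)"
    using half_pow le(1) by (meson le_trans mult_le_mono2)
  assume n2: "?n \<noteq> 2"
  show "?n ^ k < 2 ^ k * card (nonzero_tuples k R)"
  proof (cases "P = {\<zero>}")
    case True
    have "card {\<zero>, \<one>} \<le> ?n"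
      by (intro card_mono fin) auto
    then have "?n > 2"
      using one n2 by simp
    moreover have "?s = ?n - 1"
      using True fin by (simp add: card_Diff_singleton)
    ultimately have "?n < 2 * ?s"
      by simp
    then have "?n ^ k < 2 ^ k * ?s ^ k"
      using k by (metis power_strict_mono power_mult_distrib zero_le)
    also have "\<dots> \<le> 2 ^ k * card (nonzero_tuples k R)"
      using le(1) by simp
    finally show ?thesis .
  next
    case False
    then have "2 ^ k * ?s ^ k < 2 ^ k * card (nonzero_tuples k R)"
      using le(2) k by simp
    then show ?thesis
      using half_pow by linarith
  qed
qed

section \<open>The ring with two elements\<close>

lemma carrier_of_card_two:
  assumes "card (carrier R) = 2" and "\<one> \<noteq> \<zero>"
  shows "carrier R = {\<zero>, \<one>}"
proof (rule sym, rule card_subset_eq)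
  show "finite (carrier R)"
    using assms(1) by (metis card.infinite zero_neq_numeral)
qed (use assms in auto)

text \<open>A tuple with a nonzero product has no zero entry, so over two elements it is constantly \<open>\<one>\<close>.\<close>

lemma card_nonzero_tuples_of_card_two:
  assumes two: "card (carrier R) = 2" and one: "\<one> \<noteq> \<zero>"
  shows "card (nonzero_tuples k R) = 1"
proof -
  note carr = carrier_of_card_two[OF two one]
  have "nonzero_tuples k R = {restrict (\<lambda>_. \<one>) {..<k}}" (is "_ = {?u}")
  proof (intro equalityI subsetI)
    fix x assume x: "x \<in> nonzero_tuples k R"
    then have xT: "x \<in> {..<k} \<rightarrow>\<^sub>E carrier R" and prod: "(\<Otimes>i\<in>{..<k}. x i) \<noteq> \<zero>"
      by (auto simp: nonzero_tuples_def)
    have "x i = \<one>" if i: "i < k" for i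
    proof (rule ccontr)
      assume "x i \<noteq> \<one>"
      then have xi: "x i = \<zero>"
        using xT i carr by (auto simp: PiE_iff)
      have cl: "x \<in> {..<k} - {i} \<rightarrow> carrier R"
        using xT by auto
      have "{..<k} = insert i ({..<k} - {i})"
        using i by auto
      then have "(\<Otimes>i\<in>{..<k}. x i) = x i \<otimes> (\<Otimes>i\<in>{..<k} - {i}. x i)"
        using cl xi by (metis Diff_iff finite_Diff finite_lessThan finprod_insert insertI1 zero_closed)
      then show False
        using prod xi cl by simp
    qed
    then show "x \<in> {?u}"
      using xT by (auto simp: PiE_iff extensional_def)
  next
    fix x assume "x \<in> {?u}"
    then have x: "x = ?u"
      by simp
    then have "(\<Otimes>i\<in>{..<k}. x i) = \<one>"
      by (intro finprod_one_eqI) simp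
    moreover have "x \<in> {..<k} \<rightarrow>\<^sub>E carrier R"
      using x by auto
    ultimately show "x \<in> nonzero_tuples k R"
      using one unfolding nonzero_tuples_def by simp
  qed
  then show ?thesis by simp
qed

lemma iso_residue_ring_two_of_card_two:
  assumes two: "card (carrier R) = 2" and one: "\<one> \<noteq> \<zero>"
  shows "R \<simeq> residue_ring 2"
proof -
  note carr = carrier_of_card_two[OF two one]
  let ?h = "\<lambda>x. if x = \<zero> then 0 else (1::int)"
  \<comment> \<open>The sum cannot be \<open>\<one>\<close>, by cancellation.\<close>
  have char: "\<one> \<oplus> \<one> = \<zero>"
  proof -
    have "\<one> \<oplus> \<one> \<noteq> \<one>"
      using one by (metis add.r_cancel_one one_closed)
    then show ?thesis
      using carr a_closed[OF one_closed one_closed] by blast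
  qed
  have carr2: "carrier (residue_ring 2) = {0, 1}"
    by (auto simp: residue_ring_def)
  have "?h \<in> ring_iso R (residue_ring 2)"
  proof (rule ring_iso_memI)
    show "bij_betw ?h (carrier R) (carrier (residue_ring 2))"
      using carr carr2 one by (auto simp: bij_betw_def inj_on_def)
  qed (use carr one char in \<open>auto simp: residue_ring_def\<close>)
  then show ?thesis
    unfolding is_ring_iso_def by blast
qed

end

lemma card_of_iso_residue_ring_two:
  assumes "R \<simeq> residue_ring 2"
  shows "card (carrier R) = 2"
proof -
  obtain h where "bij_betw h (carrier R) (carrier (residue_ring 2))"
    using assms by (auto simp: is_ring_iso_def ring_iso_def)
  then have "card (carrier R) = card (carrier (residue_ring 2))"
    by (rule bij_betw_same_card)
  then show ?thesis
    by (simp add: residue_ring_def)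
qed

section \<open>The bound and its equality case\<close>

theorem theorem4p1:
  fixes R :: "('a, 'm) ring_scheme" and k :: nat
  assumes "cring R" and "finite (carrier R)" and "\<one>\<^bsub>R\<^esub> \<noteq> \<zero>\<^bsub>R\<^esub>" and "k \<ge> 2"
  shows "zp k R \<le> zp_bound k 2 1 \<and> (zp k R = zp_bound k 2 1 \<longleftrightarrow> R \<simeq> residue_ring 2)"
proof -
  interpret cring R by fact
  let ?n = "card (carrier R)" and ?w = "card (nonzero_tuples k R)"
  have ne: "carrier R \<noteq> {}"
    using zero_closed by blast
  have k: "k > 0"
    using assms(4) by simp
  have n: "real ?n ^ k > 0"
    using assms(2) ne by (simp add: card_gt_0_iff)
  note zp = zp_eq_one_minus_nonzero[OF assms(2) ne, of k]
  have le_iff: "zp k R \<le> zp_bound k 2 1 \<longleftrightarrow> ?n ^ k \<le> 2 ^ k * ?w"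
  proof -
    have "zp k R \<le> zp_bound k 2 1 \<longleftrightarrow> real ?n ^ k \<le> 2 ^ k * real ?w"
      using n unfolding zp zp_bound_two_one by (simp add: field_simps)
    also have "\<dots> \<longleftrightarrow> real (?n ^ k) \<le> real (2 ^ k * ?w)"
      by simp
    finally show ?thesis
      by (simp only: of_nat_le_iff)
  qed
  have eq_iff: "zp k R = zp_bound k 2 1 \<longleftrightarrow> ?n ^ k = 2 ^ k * ?w"
  proof -
    have "zp k R = zp_bound k 2 1 \<longleftrightarrow> real ?n ^ k = 2 ^ k * real ?w"
      using n unfolding zp zp_bound_two_one by (auto simp: field_simps)
    also have "\<dots> \<longleftrightarrow> real (?n ^ k) = real (2 ^ k * ?w)"
      by simp
    finally show ?thesis
      by (simp only: of_nat_eq_iff)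
  qed
  note lower = card_power_le_nonzero_tuples[OF assms(2,3) k]
  have "zp k R = zp_bound k 2 1 \<longleftrightarrow> ?n = 2"
    unfolding eq_iff using lower(2) card_nonzero_tuples_of_card_two[OF _ assms(3), of k] by force
  also have "\<dots> \<longleftrightarrow> R \<simeq> residue_ring 2"
    using iso_residue_ring_two_of_card_two[OF _ assms(3)] card_of_iso_residue_ring_two by blast
  finally show ?thesis
    using lower(1) le_iff by blast
qed

end
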